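(* Let $\triangle$ be a regular (equilateral) triangle in the Euclidean plane with vertices $A_1,A_2,A_3$ and circumradius $R$. Let $S$ be a 3-leg spider with foot points $A_1,A_2,A_3$ and three identical two-link legs with link lengths $a$ and $b$, where $R>a>b>0$. Assume that its workspace $W(S)$ is a contractible region bounded by three circular arcs and containing the incenter of $\triangle$, and that all charges are positive. Then the domain of robust Coulomb control $D(S)=W(S)\cap T(\triangle)$ of $S$ is non-void.
   Context: The workspace of $S$ is the set of possible positions of its center $X$: $W(S)=\{X\in\mathbb{R}^2: a-b\le |XA_i|\le a+b,\ i=1,2,3\}$, an intersection of three circular annuli. The Coulomb potential of charges $q_1,q_2,q_3$ placed at $A_1,A_2,A_3$ is $E(Y,q)=\sum_{i=1}^3 \frac{q_i}{|YA_i|}$, a function of $Y\in\mathbb{R}^2\setminus\{A_1,A_2,A_3\}$. For a point $X$ in the interior of $\triangle$, the stationary charges $Q(X)=(q_1,q_2,q_3)$ are the positive charges, unique up to a common positive factor, for which the gradient with respect to $Y$ of $E(Y,Q(X))$ vanishes at $Y=X$. They are given by $q_1:q_2:q_3=d_1^3\mathcal{A}_1:d_2^3\mathcal{A}_2:d_3^3\mathcal{A}_3$, where $d_i=|XA_i|$ and $\mathcal{A}_1,\mathcal{A}_2,\mathcal{A}_3$ are the areas of the triangles $A_2A_3X$, $A_3A_1X$, $A_1A_2X$. The Coulomb trapping domain $T(\triangle)$ (for positive charges) is the set of points $X$ in the interior of $\triangle$ that are minimum points of the potential $Y\mapsto E(Y,Q(X))$ with positive Hessian determinant, i.e. such that the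 determinant of the $2\times2$ Hessian matrix in $Y$ of $E(Y,Q(X))$ at $Y=X$ is positive and $X$ is a local minimum. The domain of robust Coulomb control of $S$ is $D(S)=W(S)\cap T(\triangle)$. *)

theory Defs
  imports "HOL-Analysis.Analysis"
begin

definition triangle_region :: "(3 \<Rightarrow> real^2) \<Rightarrow> (real^2) set" where
  "triangle_region A = convex hull (range A)"

definition regular_triangle :: "(3 \<Rightarrow> real^2) \<Rightarrow> bool" where
  "regular_triangle A \<longleftrightarrow> (\<exists>s>0. \<forall>i j. i \<noteq> j \<longrightarrow> dist (A i) (A j) = s)"

definition has_circumradius :: "(3 \<Rightarrow> real^2) \<Rightarrow> real \<Rightarrow> bool" where
  "has_circumradius A R \<longleftrightarrow> (\<exists>c. \<forall>i. dist c (A i) = R)"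

text \<open>The incenter is the interior point equidistant from the three side lines; the
  excenters are equidistant from these lines as well, but lie outside the triangle.\<close>

definition is_incenter :: "(3 \<Rightarrow> real^2) \<Rightarrow> real^2 \<Rightarrow> bool" where
  "is_incenter A c \<longleftrightarrow> c \<in> interior (triangle_region A) \<and>
     (\<exists>r. \<forall>i j. i \<noteq> j \<longrightarrow> infdist c (affine hull {A i, A j}) = r)"

definition workspace :: "(3 \<Rightarrow> real^2) \<Rightarrow> real \<Rightarrow> real \<Rightarrow> (real^2) set" where
  "workspace A a b = {X. \<forall>i. a - b \<le> dist X (A i) \<and> dist X (A i) \<le> a + b}"

text \<open>The counterpart in \<open>real^2\<close> of the library's \<open>part_circlepath\<close>.\<close>

definition circular_arc :: "real^2 \<Rightarrow> real \<Rightarrow> real \<Rightarrow> real \<Rightarrow> real \<Rightarrow> real^2" where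
  "circular_arc c r s t =
     (\<lambda>u. c + r *\<^sub>R vector [cos (linepath s t u), sin (linepath s t u)])"

definition is_circular_arc :: "(real \<Rightarrow> real^2) \<Rightarrow> bool" where
  "is_circular_arc g \<longleftrightarrow> (\<exists>c r s t. r > 0 \<and> g = circular_arc c r s t)"

text \<open>The boundary is a Jordan curve composed of three arcs. Simplicity of the closed
  path rules out degenerate arcs, arcs going once or more around their circle, and any
  common points of the arcs apart from the three corners.\<close>

definition bounded_by_three_circular_arcs :: "(real^2) set \<Rightarrow> bool" where
  "bounded_by_three_circular_arcs S \<longleftrightarrow>
     (\<exists>g1 g2 g3. is_circular_arc g1 \<and> is_circular_arc g2 \<and> is_circular_arc g3 \<and>
        pathfinish g1 = pathstart g2 \<and> pathfinish g2 = pathstart g3 \<and>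
        pathfinish g3 = pathstart g1 \<and>
        simple_path (g1 +++ g2 +++ g3) \<and>
        frontier S = path_image (g1 +++ g2 +++ g3))"

text \<open>At the points \<open>A i\<close> the potential takes the junk value given by \<open>x / 0 = 0\<close>; below it
  is only differentiated and minimised locally at interior points of the triangle.\<close>

definition coulomb_potential :: "(3 \<Rightarrow> real^2) \<Rightarrow> (3 \<Rightarrow> real) \<Rightarrow> real^2 \<Rightarrow> real" where
  "coulomb_potential A q Y = (\<Sum>i\<in>UNIV. q i / dist Y (A i))"

definition partial_deriv :: "'n \<Rightarrow> (real^'n \<Rightarrow> real) \<Rightarrow> real^'n \<Rightarrow> real" where
  "partial_deriv i f Y = deriv (\<lambda>t. f (Y + t *\<^sub>R axis i 1)) 0"

definition hessian :: "(real^'n \<Rightarrow> real) \<Rightarrow> real^'n \<Rightarrow> real^'n^'n" where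
  "hessian f X = (\<chi> i j. partial_deriv i (partial_deriv j f) X)"

definition local_minimum :: "(real^2 \<Rightarrow> real) \<Rightarrow> real^2 \<Rightarrow> bool" where
  "local_minimum f X \<longleftrightarrow> (\<forall>\<^sub>F Y in nhds X. f X \<le> f Y)"

definition stationary_charges :: "(3 \<Rightarrow> real^2) \<Rightarrow> real^2 \<Rightarrow> (3 \<Rightarrow> real) \<Rightarrow> bool" where
  "stationary_charges A X q \<longleftrightarrow> (\<forall>i. q i > 0) \<and> GDERIV (coulomb_potential A q) X :> 0"

text \<open>Stationary charges at an interior point exist and are unique up to a positive factor,
  on which the conditions below do not depend; so any choice of them may be used.\<close>

definition coulomb_trapping_domain :: "(3 \<Rightarrow> real^2) \<Rightarrow> (real^2) set" where
  "coulomb_trapping_domain A =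
     {X \<in> interior (triangle_region A).
        \<exists>q. stationary_charges A X q \<and>
            local_minimum (coulomb_potential A q) X \<and>
            det (hessian (coulomb_potential A q) X) > 0}"

definition robust_control_domain :: "(3 \<Rightarrow> real^2) \<Rightarrow> real \<Rightarrow> real \<Rightarrow> (real^2) set" where
  "robust_control_domain A a b = workspace A a b \<inter> coulomb_trapping_domain A"

end

(* The incenter c of a regular triangle has equal barycentric coordinates, hence is its centroid
   and circumcenter, so it lies in the trapping domain with equal charges: the unit vectors u_k
   from the vertices to c form a tight frame, and the Hessian, the sum of (3 u_k u_k^T - I) / r^3,
   equals 3/2 I / r^3. *)

theory Submission
  imports Defs
begin

section \<open>The incenter of a regular triangle is its centroid\<close>

lemma three_scaleR: "3 *\<^sub>R x = x + x + (x :: 'a::real_vector)"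
  using scaleR_left_distrib[of 2 1 x] by (simp add: scaleR_2)

text \<open>Up to the height of the triangle over \<open>Q S\<close>, the weight of \<open>P\<close>
  is the distance to the opposite side. So equal distances to the sides of a regular triangle will
  force equal weights.\<close>

lemma incenter_weight:
  fixes P Q S :: "real^2"
  assumes "dist P Q = dist P S" and "w \<ge> 0" and "w + v + u = 1"
  shows "infdist (w *\<^sub>R P + v *\<^sub>R Q + u *\<^sub>R S) (affine hull {Q, S}) = w * dist P (midpoint Q S)"
proof -
  define m where "m = midpoint Q S"
  define x where "x = w *\<^sub>R P + v *\<^sub>R Q + u *\<^sub>R S"
  \<comment> \<open>Replacing \<open>P\<close> by the foot \<open>m\<close> of its height gives the
    foot \<open>p\<close> of the perpendicular from \<open>x\<close>, because \<open>x - p\<close>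
    is a multiple of \<open>P - m\<close>. Pythagoras then shows that \<open>p\<close> is the
    nearest point of the line.\<close>
  define p where "p = w *\<^sub>R m + v *\<^sub>R Q + u *\<^sub>R S"
  have p_alt: "p = (w/2 + v) *\<^sub>R Q + (w/2 + u) *\<^sub>R S"
    by (simp add: p_def m_def midpoint_def algebra_simps)
  have p_in: "p \<in> affine hull {Q, S}"
    unfolding affine_hull_2 p_alt using assms(3)
    by (intro CollectI exI[of _ "w/2 + v"] exI[of _ "w/2 + u"]) auto
  have orth: "(P - m) \<bullet> (Q - S) = 0"
  proof -
    have "(dist P Q)\<^sup>2 = (dist P S)\<^sup>2" using assms(1) by simp
    then show ?thesis
      by (simp add: m_def midpoint_def dist_norm power2_norm_eq_inner algebra_simps inner_commute)
  qed
  have xp: "x - p = w *\<^sub>R (P - m)"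
    by (simp add: x_def p_def algebra_simps)
  have le: "dist x p \<le> dist x y" if y: "y \<in> affine hull {Q, S}" for y
  proof -
    obtain c d where cd: "y = c *\<^sub>R Q + d *\<^sub>R S" "c + d = 1"
      using y unfolding affine_hull_2 by blast
    have d: "d = 1 - c" and wu: "w/2 + u = 1 - (w/2 + v)" using cd(2) assms(3) by auto
    have py: "p - y = (w/2 + v - c) *\<^sub>R (Q - S)"
      unfolding p_alt cd(1) d wu by (simp only: algebra_simps)
    have "orthogonal (x - p) (p - y)"
      by (simp add: xp py orthogonal_def orth)
    then have "(norm (x - y))\<^sup>2 = (norm (x - p))\<^sup>2 + (norm (p - y))\<^sup>2"
      using norm_add_Pythagorean[of "x - p" "p - y"] by simp
    then show ?thesis
      by (simp add: dist_norm power2_le_imp_le)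
  qed
  have "infdist x (affine hull {Q, S}) = dist x p"
  proof (rule antisym)
    show "infdist x (affine hull {Q, S}) \<le> dist x p"
      by (rule infdist_le[OF p_in])
    show "dist x p \<le> infdist x (affine hull {Q, S})"
      using p_in le by (subst infdist_notempty) (auto intro!: cINF_greatest)
  qed
  also have "\<dots> = w * dist P m"
    using assms(2) by (simp add: dist_norm xp)
  finally show ?thesis by (simp add: x_def m_def)
qed

lemma dist_midpoint_equilateral:
  fixes P Q S :: "'a::real_inner"
  assumes "dist P Q = s" "dist P S = s" "dist Q S = s"
  shows "(dist P (midpoint Q S))\<^sup>2 = 3/4 * s\<^sup>2"
proof -
  have "(norm (P - Q))\<^sup>2 = s\<^sup>2" "(norm (P - S))\<^sup>2 = s\<^sup>2" "(norm (Q - S))\<^sup>2 = s\<^sup>2"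
    using assms by (auto simp: dist_norm)
  then show ?thesis
    by (simp add: midpoint_def dist_norm power2_norm_eq_inner algebra_simps inner_commute)
qed

text \<open>Each distance to a side line is a weight times the common height \<open>h\<close>, so
  the three weights agree and equal 1/3. Membership in the convex hull makes the weights
  nonnegative; distances alone would fix them only up to sign, which would admit the
  excenters.\<close>

lemma incenter_regular_triangle:
  assumes "regular_triangle A" and "is_incenter A c"
  shows "3 *\<^sub>R c = A 1 + A 2 + A 3"
proof -
  obtain s where s: "s > 0" "\<And>i j. i \<noteq> j \<Longrightarrow> dist (A i) (A j) = s"
    using assms(1) by (auto simp: regular_triangle_def)
  obtain r where c: "c \<in> interior (triangle_region A)"
    and r: "\<And>i j. i \<noteq> j \<Longrightarrow> infdist c (affine hull {A i, A j}) = r"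
    using assms(2) by (auto simp: is_incenter_def)
  have "range A = {A 1, A 2, A 3}" by (auto simp: UNIV_3)
  then have "c \<in> convex hull {A 1, A 2, A 3}"
    using c interior_subset by (metis subsetD triangle_region_def)
  then obtain w v u where w: "w \<ge> 0" "v \<ge> 0" "u \<ge> 0" "w + v + u = 1"
    and ceq: "c = w *\<^sub>R A 1 + v *\<^sub>R A 2 + u *\<^sub>R A 3"
    unfolding convex_hull_3 by auto
  define h where "h = sqrt (3/4 * s\<^sup>2)"
  have h: "dist (A i) (midpoint (A j) (A k)) = h" if "i \<noteq> j" "i \<noteq> k" "j \<noteq> k" for i j k
    unfolding h_def using dist_midpoint_equilateral[of "A i" "A j" s "A k"] s that
    by (metis real_sqrt_unique zero_le_dist)
  have "h > 0" using s by (simp add: h_def)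
  have "r = w * h"
    using incenter_weight[of "A 1" "A 2" "A 3" w v u] s w h r by (simp add: ceq)
  moreover have "r = v * h"
    using incenter_weight[of "A 2" "A 1" "A 3" v w u] s w h r by (simp add: ceq add_ac)
  moreover have "r = u * h"
    using incenter_weight[of "A 3" "A 1" "A 2" u w v] s w h r by (simp add: ceq add_ac)
  ultimately have "w = 1/3" "v = 1/3" "u = 1/3" using \<open>h > 0\<close> w(4) by auto
  then show ?thesis by (simp add: ceq algebra_simps)
qed

section \<open>A quadratic lower bound for the reciprocal\<close>

text \<open>The right-hand side agrees with \<open>1/w\<close> to first order in \<open>w\<^sup>2 - 1\<close>; the coefficient of
  the quadratic term lies between 1/4, where the sum over the three charges turns convex,
  and the Taylor coefficient 3/8.\<close>
lemma inverse_ge_quadratic: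
  fixes w :: real
  assumes "0 < w" "w \<le> 21/20"
  shows "1 - (w\<^sup>2 - 1)/2 + 5/16 * (w\<^sup>2 - 1)\<^sup>2 \<le> 1 / w"
proof -
  \<comment> \<open>The claim times \<open>w\<close> is the nonnegativity of a polynomial with a
    double root at \<open>w = 1\<close>. Its cofactor, multiplied by 16, is
    \<open>8 * w + 16 - 5 * (w * (w + 1)\<^sup>2)\<close>, which is estimated here by bounding one
    factor \<open>w + 1\<close> crudely.\<close>
  have "w * (w + 1)\<^sup>2 \<le> w * (21/20 + 1)\<^sup>2"
    using assms by (intro mult_mono power_mono) auto
  moreover have "8 * w + 16 \<ge> 5 * (w * (21/20 + 1)\<^sup>2)"
    using assms by (simp add: power2_eq_square)
  ultimately have "(w + 2)/2 - 5/16 * (w * (w + 1)\<^sup>2) \<ge> 0"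
    by (simp add: field_simps)
  then have "(w - 1)\<^sup>2 * ((w + 2)/2 - 5/16 * (w * (w + 1)\<^sup>2)) \<ge> 0"
    by simp
  also have "(w - 1)\<^sup>2 * ((w + 2)/2 - 5/16 * (w * (w + 1)\<^sup>2))
    = 1 - w * (1 - (w\<^sup>2 - 1)/2 + 5/16 * (w\<^sup>2 - 1)\<^sup>2)"
    by (simp add: field_simps power2_eq_square)
  finally show ?thesis using assms by (simp add: field_simps)
qed

section \<open>Derivatives of the potential with equal charges\<close>

lemma DERIV_norm_line:
  fixes v :: "real^'n"
  assumes "v \<noteq> 0"
  shows "((\<lambda>t. norm (v + t *\<^sub>R axis i 1)) has_real_derivative v $ i / norm v) (at 0)"
proof -
  have "((\<lambda>t. norm (v + t *\<^sub>R axis i 1)) has_derivative (\<lambda>t. (t *\<^sub>R axis i 1) \<bullet> sgn v)) (at 0)"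
    using assms by (intro has_derivative_compose[of "\<lambda>t. v + t *\<^sub>R axis i 1" _ _ _ norm, simplified])
      (auto intro!: derivative_eq_intros has_derivative_norm)
  then show ?thesis
    by (rule has_derivative_imp_has_field_derivative)
      (simp add: sgn_div_norm inner_axis' divide_inverse)
qed

context
  fixes A :: "3 \<Rightarrow> real^2"
begin

text \<open>At the centroid of a regular triangle the distances to the vertices agree, and so do the
  areas of the three subtriangles; hence the stationary charges are equal and may be scaled to
  1.\<close>

abbreviation unit_potential :: "real^2 \<Rightarrow> real" where
  "unit_potential \<equiv> coulomb_potential A (\<lambda>_. 1)"

lemma partial_deriv_unit_potential:
  assumes "Y \<notin> range A"
  shows "partial_deriv j unit_potential Y = - (\<Sum>k\<in>UNIV. (Y - A k) $ j / norm (Y - A k) ^ 3)"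
proof -
  have "((\<lambda>t. unit_potential (Y + t *\<^sub>R axis j 1)) has_real_derivative
      (\<Sum>k\<in>UNIV. - ((Y - A k) $ j / norm (Y - A k) ^ 3))) (at 0)"
    unfolding coulomb_potential_def
  proof (rule DERIV_sum)
    fix k
    have nz: "Y - A k \<noteq> 0" using assms by auto
    have "((\<lambda>t. 1 / norm ((Y - A k) + t *\<^sub>R axis j 1)) has_real_derivative
      - ((Y - A k) $ j / norm (Y - A k) ^ 3)) (at 0)"
      using nz by (auto intro!: derivative_eq_intros DERIV_norm_line simp: power3_eq_cube)
    then show "((\<lambda>t. 1 / dist (Y + t *\<^sub>R axis j 1) (A k)) has_real_derivative
      - ((Y - A k) $ j / norm (Y - A k) ^ 3)) (at 0)"
      by (simp add: dist_norm algebra_simps)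
  qed
  then show ?thesis
    by (simp add: partial_deriv_def DERIV_imp_deriv sum_negf)
qed

lemma hessian_unit_potential:
  assumes "Y \<notin> range A"
  shows "hessian unit_potential Y $ i $ j =
    (\<Sum>k\<in>UNIV. 3 * (Y - A k) $ i * (Y - A k) $ j / norm (Y - A k) ^ 5
                - (if i = j then 1 else 0) / norm (Y - A k) ^ 3)"
proof -
  \<comment> \<open>The formula for the first partial derivative holds only off the vertices.
    Differentiating it once more needs it on a neighbourhood of \<open>Y\<close>, which openness of
    the complement of the vertex set provides.\<close>
  have "open (- range A)" by (simp add: finite_imp_closed open_Compl)
  then have "\<forall>\<^sub>F Z in nhds Y. Z \<in> - range A"
    using assms by (intro eventually_nhds_in_open) auto
  moreover have "filterlim (\<lambda>t. Y + t *\<^sub>R axis i 1) (nhds Y) (nhds 0)"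
    by (auto intro!: tendsto_eq_intros filterlim_ident)
  ultimately have "\<forall>\<^sub>F t in nhds 0. Y + t *\<^sub>R axis i 1 \<in> - range A"
    unfolding filterlim_iff by blast
  then have ev: "\<forall>\<^sub>F t in nhds 0. partial_deriv j unit_potential (Y + t *\<^sub>R axis i 1)
     = (\<Sum>k\<in>UNIV. - ((Y + t *\<^sub>R axis i 1 - A k) $ j / norm (Y + t *\<^sub>R axis i 1 - A k) ^ 3))"
    by (elim eventually_mono) (simp add: partial_deriv_unit_potential sum_negf)
  have "((\<lambda>t. \<Sum>k\<in>UNIV. - ((Y + t *\<^sub>R axis i 1 - A k) $ j / norm (Y + t *\<^sub>R axis i 1 - A k) ^ 3))
    has_real_derivative (\<Sum>k\<in>UNIV. 3 * (Y - A k) $ i * (Y - A k) $ j / norm (Y - A k) ^ 5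
                - (if i = j then 1 else 0) / norm (Y - A k) ^ 3)) (at 0)"
  proof (rule DERIV_sum)
    fix k
    define v where "v = Y - A k"
    have nz: "v \<noteq> 0" using assms by (auto simp: v_def)
    have "((\<lambda>t. - ((v $ j + t * (if i = j then 1 else 0)) / norm (v + t *\<^sub>R axis i 1) ^ 3))
      has_real_derivative 3 * v $ i * v $ j / norm v ^ 5 - (if i = j then 1 else 0) / norm v ^ 3) (at 0)"
      using nz by (auto intro!: derivative_eq_intros DERIV_norm_line
          simp: divide_simps eval_nat_numeral) (simp_all add: algebra_simps)
    moreover have "Y + t *\<^sub>R axis i 1 - A k = v + t *\<^sub>R axis i 1"
      and "(v + t *\<^sub>R axis i 1) $ j = v $ j + t * (if i = j then 1 else 0)" for t
      by (auto simp: v_def axis_def)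
    ultimately show "((\<lambda>t. - ((Y + t *\<^sub>R axis i 1 - A k) $ j / norm (Y + t *\<^sub>R axis i 1 - A k) ^ 3))
      has_real_derivative 3 * (Y - A k) $ i * (Y - A k) $ j / norm (Y - A k) ^ 5
                - (if i = j then 1 else 0) / norm (Y - A k) ^ 3) (at 0)"
      by (simp only: v_def[symmetric])
  qed
  then show ?thesis
    by (simp add: hessian_def partial_deriv_def[of i] deriv_cong_ev[OF ev refl] DERIV_imp_deriv)
qed

text \<open>\<open>GDERIV\<close> in the definition of stationary charges asks for total
  differentiability, which existence of the partial derivatives does not give.\<close>

lemma differentiable_unit_potential:
  assumes "Y \<notin> range A"
  shows "unit_potential differentiable (at Y)"
proof -
  have "dist Y (A k) \<noteq> 0" "Y - A k \<noteq> 0" for k using assms by auto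
  then show ?thesis
    unfolding coulomb_potential_def dist_norm
    by (intro differentiable_sum ballI differentiable_divide differentiable_const
        differentiable_compose[of norm "\<lambda>x. x - A _"] differentiable_norm_at
        differentiable_diff differentiable_ident) auto
qed

end

section \<open>Three vectors of equal length with sum zero\<close>

text \<open>Read the vectors as complex numbers \<open>z1\<close>, \<open>z2\<close>,
  \<open>z3\<close>. The sum of their squares vanishes, so the matrix of the sums is a multiple of
  the identity, and its trace \<open>3 * r\<^sup>2\<close> fixes the factor.\<close>

lemma frame_identities:
  fixes u :: "3 \<Rightarrow> real^2"
  assumes "u 1 + u 2 + u 3 = 0" and "\<And>k. norm (u k) = r"
  shows "(\<Sum>k\<in>UNIV. u k $ i * u k $ j) = (if i = j then 3/2 * r\<^sup>2 else 0)"
proof -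
  define x1 y1 x2 y2 where d: "x1 = u 1 $ 1" "y1 = u 1 $ 2" "x2 = u 2 $ 1" "y2 = u 2 $ 2"
  have u3: "u 3 = - u 1 - u 2" using assms(1) by (simp add: eq_neg_iff_add_eq_0 algebra_simps)
  then have e3: "u 3 $ 1 = - x1 - x2" "u 3 $ 2 = - y1 - y2" by (auto simp: d)
  have n: "u k $ 1 ^ 2 + u k $ 2 ^ 2 = r\<^sup>2" for k
    using assms(2)[of k] by (auto simp: norm_vec_def L2_set_def sum_2)
  have n1: "x1\<^sup>2 + y1\<^sup>2 = r\<^sup>2" and n2: "x2\<^sup>2 + y2\<^sup>2 = r\<^sup>2"
    and n3: "(- x1 - x2)\<^sup>2 + (- y1 - y2)\<^sup>2 = r\<^sup>2"
    using n[of 1] n[of 2] n[of 3] by (auto simp: d e3 simp del: One_nat_def)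
  have p: "x1*x2 + y1*y2 = - r\<^sup>2/2" using n1 n2 n3 by (simp add: power2_eq_square algebra_simps)
  \<comment> \<open>\<open>P\<close> and \<open>Q\<close> are the real and imaginary parts of
    \<open>z1\<^sup>2 + z1*z2 + z2\<^sup>2\<close>, half the sum of the three squares since
    \<open>z3 = - z1 - z2\<close>. The squared modulus depends only on the lengths and the inner
    product of \<open>u 1\<close> and \<open>u 2\<close>, and is zero for the values found
    above.\<close>
  define P Q where "P = x1\<^sup>2 - y1\<^sup>2 + x1*x2 - y1*y2 + x2\<^sup>2 - y2\<^sup>2"
    and "Q = 2*x1*y1 + x1*y2 + x2*y1 + 2*x2*y2"
  have "P\<^sup>2 + Q\<^sup>2 = (x1\<^sup>2 + y1\<^sup>2)\<^sup>2 + (x2\<^sup>2 + y2\<^sup>2)\<^sup>2 - (x1\<^sup>2 + y1\<^sup>2)*(x2\<^sup>2 + y2\<^sup>2)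
     + 2*(x1\<^sup>2 + y1\<^sup>2 + (x2\<^sup>2 + y2\<^sup>2)) * (x1*x2 + y1*y2) + 4*(x1*x2 + y1*y2)\<^sup>2"
    unfolding P_def Q_def by algebra
  also have "\<dots> = 0" unfolding n1 n2 p by (simp add: power2_eq_square algebra_simps)
  finally have "P = 0" "Q = 0" by (auto simp: sum_power2_eq_zero_iff)
  then show ?thesis
    using n1 n2 p exhaust_2[of i] exhaust_2[of j] unfolding P_def Q_def
    by (auto simp: sum_3 e3 d(1-4)[symmetric] power2_eq_square algebra_simps)
qed

text \<open>The same identities as a quadratic form, as needed for the second-order term of the
  potential.\<close>

lemma frame_inner_sum:
  fixes u :: "3 \<Rightarrow> real^2"
  assumes "u 1 + u 2 + u 3 = 0" and "\<And>k. norm (u k) = r"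
  shows "(\<Sum>k\<in>UNIV. (u k \<bullet> h)\<^sup>2) = 3/2 * r\<^sup>2 * (norm h)\<^sup>2"
proof -
  note f = frame_identities[OF assms]
  have "(\<Sum>k\<in>UNIV. (u k \<bullet> h)\<^sup>2) = (\<Sum>k\<in>UNIV. u k $ 1 * u k $ 1) * (h $ 1)\<^sup>2
    + (\<Sum>k\<in>UNIV. u k $ 2 * u k $ 2) * (h $ 2)\<^sup>2 + 2 * (\<Sum>k\<in>UNIV. u k $ 1 * u k $ 2) * (h $ 1 * h $ 2)"
    by (simp add: inner_vec_def sum_2 sum_3 power2_eq_square algebra_simps)
  also have "\<dots> = 3/2 * r\<^sup>2 * ((h $ 1)\<^sup>2 + (h $ 2)\<^sup>2)"
    unfolding f by (simp add: algebra_simps)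
  also have "(h $ 1)\<^sup>2 + (h $ 2)\<^sup>2 = (norm h)\<^sup>2"
    by (simp add: norm_vec_def L2_set_def sum_2)
  finally show ?thesis .
qed

section \<open>The centroid lies in the trapping domain\<close>

text \<open>Minimality is shown on an explicit disc, independently of the Hessian: each summand is
  bounded below by a quadratic polynomial in the relative change \<open>t k\<close> of the squared
  distance, and the sums of \<open>t k\<close> and of its squares depend on \<open>h\<close> only
  through its length.\<close>

lemma unit_potential_local_minimum:
  fixes A :: "3 \<Rightarrow> real^2"
  assumes sum: "3 *\<^sub>R c = A 1 + A 2 + A 3" and r: "\<And>k. dist c (A k) = r" and "r > 0"
  shows "local_minimum (coulomb_potential A (\<lambda>_. 1)) c"
  unfolding local_minimum_def eventually_nhds_metric
proof (intro exI[of _ "r/20"] conjI allI impI)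
  \<comment> \<open>The radius \<open>r/20\<close> keeps every ratio \<open>dist Y (A k) / r\<close>
    positive and at most 21/20, the range of \<open>inverse_ge_quadratic\<close>.\<close>
  show "0 < r/20" using assms by simp
  fix Y assume Y: "dist Y c < r/20"
  define u where "u k = c - A k" for k
  define h where "h = Y - c"
  have u0: "u 1 + u 2 + u 3 = 0"
    using sum by (simp add: u_def three_scaleR algebra_simps)
  have ur: "norm (u k) = r" for k using r[of k] by (simp add: u_def dist_norm)
  define t where "t k = ((norm h)\<^sup>2 + 2 * (u k \<bullet> h)) / r\<^sup>2" for k
  have bound: "1/r * (1 - t k / 2 + 5/16 * (t k)\<^sup>2) \<le> 1 / dist Y (A k)" for k
  proof -
    define w where "w = dist Y (A k) / r"
    have "dist Y (A k) \<le> 21/20 * r" using dist_triangle[of Y "A k" c] r[of k] Y by simp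
    moreover have "dist Y (A k) > 0"
      using dist_triangle[of c "A k" Y] r[of k] Y \<open>r > 0\<close> dist_commute[of c Y] by linarith
    ultimately have "0 < w" "w \<le> 21/20" using \<open>r > 0\<close> by (auto simp: w_def field_simps)
    note this' = inverse_ge_quadratic[OF this]
    have "(dist Y (A k))\<^sup>2 = (norm (u k + h))\<^sup>2" by (simp add: dist_norm u_def h_def)
    also have "\<dots> = r\<^sup>2 + ((norm h)\<^sup>2 + 2 * (u k \<bullet> h))"
      by (simp flip: ur[of k] add: power2_norm_eq_inner inner_add inner_commute)
    finally have "w\<^sup>2 - 1 = t k"
      using \<open>r > 0\<close> by (simp add: w_def t_def power_divide field_simps)
    then have "1/r * (1 - t k / 2 + 5/16 * (t k)\<^sup>2) \<le> 1/r * (1 / w)"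
      using this' \<open>r > 0\<close> by (intro mult_left_mono) auto
    then show ?thesis using \<open>r > 0\<close> by (simp add: w_def)
  qed
  define e where "e = (norm h)\<^sup>2 / r\<^sup>2"
  have i0: "u 1 \<bullet> h + u 2 \<bullet> h + u 3 \<bullet> h = 0"
    using u0 by (metis inner_add_left inner_zero_left)
  have t1: "(\<Sum>k\<in>UNIV. t k) = 3 * e"
    using i0 by (simp add: sum_3 t_def e_def flip: add_divide_distrib)
  have "(\<Sum>k\<in>UNIV. (t k)\<^sup>2) = (3 * (norm h)^4 + 4 * (norm h)\<^sup>2 * (u 1 \<bullet> h + u 2 \<bullet> h + u 3 \<bullet> h)
      + 4 * (\<Sum>k\<in>UNIV. (u k \<bullet> h)\<^sup>2)) / r^4"
    by (simp add: sum_3 t_def power_divide flip: add_divide_distrib)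
      (simp add: eval_nat_numeral algebra_simps)
  also have "\<dots> = 3 * e\<^sup>2 + 6 * e"
    unfolding i0 frame_inner_sum[of u, OF u0 ur] using \<open>r > 0\<close>
    by (simp add: e_def field_simps eval_nat_numeral)
  finally have t2: "(\<Sum>k\<in>UNIV. (t k)\<^sup>2) = 3 * e\<^sup>2 + 6 * e" .
  have "e \<ge> 0" by (simp add: e_def)
  have "coulomb_potential A (\<lambda>_. 1) c = 1/r * 3"
    using r by (simp add: coulomb_potential_def sum_3)
  \<comment> \<open>After the values of both sums are inserted, the bracket exceeds 3 by
    \<open>3/8 * e + 15/16 * e\<^sup>2\<close>: the quadratic term contributes
    \<open>15/8 * e\<close>, more than the \<open>3/2 * e\<close> lost in the linear one.\<close>
  also have "\<dots> \<le> 1/r * (3 - (\<Sum>k\<in>UNIV. t k) / 2 + 5/16 * (\<Sum>k\<in>UNIV. (t k)\<^sup>2))"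
    using \<open>r > 0\<close> \<open>e \<ge> 0\<close> unfolding t1 t2 by (intro mult_left_mono) auto
  also have "\<dots> = (\<Sum>k\<in>UNIV. 1/r * (1 - t k / 2 + 5/16 * (t k)\<^sup>2))"
    by (simp add: sum_3 algebra_simps add_divide_distrib)
  also have "\<dots> \<le> coulomb_potential A (\<lambda>_. 1) Y"
    unfolding coulomb_potential_def by (intro sum_mono bound)
  finally show "coulomb_potential A (\<lambda>_. 1) c \<le> coulomb_potential A (\<lambda>_. 1) Y" .
qed

lemma det_hessian_unit_potential_pos:
  fixes A :: "3 \<Rightarrow> real^2"
  assumes sum: "3 *\<^sub>R c = A 1 + A 2 + A 3" and r: "\<And>k. dist c (A k) = r" and "r > 0"
  shows "det (hessian (coulomb_potential A (\<lambda>_. 1)) c) > 0"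
proof -
  define u where "u k = c - A k" for k
  have u0: "u 1 + u 2 + u 3 = 0"
    using sum by (simp add: u_def three_scaleR algebra_simps)
  have ur: "norm (u k) = r" for k using r[of k] by (simp add: u_def dist_norm)
  have "c \<notin> range A" using r \<open>r > 0\<close> by fastforce
  then have "hessian (coulomb_potential A (\<lambda>_. 1)) c $ i $ j =
    (\<Sum>k\<in>UNIV. 3 * u k $ i * u k $ j / r ^ 5 - (if i = j then 1 else 0) / r ^ 3)" for i j
    by (simp only: hessian_unit_potential u_def[symmetric] ur not_False_eq_True)
  also have "\<dots> i j = 3 / r ^ 5 * (\<Sum>k\<in>UNIV. u k $ i * u k $ j) - 3 * (if i = j then 1 else 0) / r ^ 3" for i j
    by (simp add: sum_subtractf sum_distrib_left mult.assoc)
  also have "\<dots> i j = (if i = j then 3 / (2 * r ^ 3) else 0)" for i j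
    unfolding frame_identities[of u, OF u0 ur] using \<open>r > 0\<close>
    by (simp add: field_simps eval_nat_numeral)
  finally have "hessian (coulomb_potential A (\<lambda>_. 1)) c $ i $ j = (if i = j then 3 / (2 * r ^ 3) else 0)" for i j .
  then show ?thesis using \<open>r > 0\<close> by (simp add: det_2)
qed

text \<open>Stationarity comes from Fermat's theorem: the potential is differentiable at
  \<open>c\<close> and has a local minimum there, so its derivative vanishes.\<close>

lemma centroid_in_trapping_domain:
  fixes A :: "3 \<Rightarrow> real^2"
  assumes "3 *\<^sub>R c = A 1 + A 2 + A 3" and "\<And>k. dist c (A k) = r" and "r > 0"
    and "c \<in> interior (triangle_region A)"
  shows "c \<in> coulomb_trapping_domain A"
proof -
  let ?E = "coulomb_potential A (\<lambda>_. 1)"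
  note min = unit_potential_local_minimum[OF assms(1-3)]
  have "c \<notin> range A" using assms(2,3) by fastforce
  then obtain f' where f': "(?E has_derivative f') (at c)"
    using differentiable_unit_potential unfolding differentiable_def by blast
  obtain d where "d > 0" "\<forall>y\<in>ball c d. ?E c \<le> ?E y"
    using min unfolding local_minimum_def eventually_nhds_metric
    by (auto simp: dist_commute)
  then have "f' = (\<lambda>v. 0)"
    using differential_zero_maxmin[of c "ball c d" ?E f'] f' by auto
  then have "stationary_charges A c (\<lambda>_. 1)"
    using f' by (simp add: stationary_charges_def gderiv_def)
  then show ?thesis
    using min det_hessian_unit_potential_pos[OF assms(1-3)] assms(4)
    unfolding coulomb_trapping_domain_def by blast
qed

section \<open>Equidistance of the centroid from the vertices, and the conclusion\<close>

lemma centroid_equidistant: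
  assumes "regular_triangle A" and "3 *\<^sub>R c = A 1 + A 2 + A 3"
  shows "\<exists>r>0. \<forall>k. dist c (A k) = r"
proof -
  obtain s where s: "s > 0" "\<And>i j. i \<noteq> j \<Longrightarrow> dist (A i) (A j) = s"
    using assms(1) by (auto simp: regular_triangle_def)
  have *: "dist c P = s / sqrt 3"
    if "3 *\<^sub>R c = P + Q + T" "dist P Q = s" "dist P T = s" "dist Q T = s" for P Q T
  proof -
    \<comment> \<open>The centroid divides the median from \<open>P\<close> in the ratio 2:1, so its
      distance to \<open>P\<close> is two thirds of the height.\<close>
    have "3 *\<^sub>R (c - P) = 2 *\<^sub>R (midpoint Q T - P)"
      using that(1) by (simp add: three_scaleR midpoint_def scaleR_2 algebra_simps)
    then have "norm (3 *\<^sub>R (c - P)) = norm (2 *\<^sub>R (midpoint Q T - P))"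
      by simp
    then have "3 * dist c P = 2 * dist P (midpoint Q T)"
      by (simp add: dist_norm norm_minus_commute)
    then have "(3 * dist c P)\<^sup>2 = 4 * (dist P (midpoint Q T))\<^sup>2" by simp
    then have "(dist c P)\<^sup>2 = s\<^sup>2 / 3"
      unfolding dist_midpoint_equilateral[OF that(2-4)] by (simp add: power_mult_distrib)
    then have "dist c P = sqrt (s\<^sup>2 / 3)"
      by (metis real_sqrt_unique zero_le_dist)
    then show ?thesis using s(1) by (simp add: real_sqrt_divide)
  qed
  have "dist c (A k) = s / sqrt 3" for k
  proof -
    have "dist c (A 1) = s / sqrt 3"
      by (rule *[of _ "A 2" "A 3"]) (auto simp: assms(2) s)
    moreover have "dist c (A 2) = s / sqrt 3"
      by (rule *[of _ "A 1" "A 3"]) (auto simp: assms(2) s)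
    moreover have "dist c (A 3) = s / sqrt 3"
      by (rule *[of _ "A 1" "A 2"]) (auto simp: assms(2) s)
    ultimately show ?thesis using exhaust_3[of k] by auto
  qed
  then show ?thesis using s(1) by (intro exI[of _ "s / sqrt 3"]) auto
qed

theorem corollary1:
  fixes A :: "3 \<Rightarrow> real^2" and R a b :: real
  assumes "regular_triangle A"
    and "has_circumradius A R"
    and "R > a" and "a > b" and "b > 0"
    and "contractible (workspace A a b)"
    and "bounded_by_three_circular_arcs (workspace A a b)"
    and "\<exists>c. is_incenter A c \<and> c \<in> workspace A a b"
  shows "robust_control_domain A a b \<noteq> {}"
proof -
  obtain c where c: "is_incenter A c" "c \<in> workspace A a b" using assms(8) by blast
  note centroid = incenter_regular_triangle[OF assms(1) c(1)]
  obtain r where "r > 0" "\<And>k. dist c (A k) = r"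
    using centroid_equidistant[OF assms(1) centroid] by blast
  then have "c \<in> coulomb_trapping_domain A"
    using centroid_in_trapping_domain[OF centroid] c(1) by (auto simp: is_incenter_def)
  then show ?thesis using c(2) by (auto simp: robust_control_domain_def)
qed

end
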